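(* Consider conditional inequalities $$(\bm c_1\cdot\bm h\ge0\ \wedge\cdots\wedge\ \bm c_k\cdot\bm h\ge0)\ \Rightarrow\ \bm c_0\cdot\bm h\ge0 .$$ If all antecedents $\bm c_1,\dots,\bm c_k$ are tight, then the corresponding decision problem $\mathrm{AECIIP}$ (check whether the conditional inequality holds for all $\bm h\in\overline{\Gamma}_n^*$) is in $\Pi^0_3$. That is, $\mathrm{AECIIP}$ restricted to inputs whose antecedents are all tight is in $\Pi^0_3$.
   Context: All logarithms are in base 2. A random variable $X$ with finite domain $D$ and probability mass function $p$ has entropy $H(X)=-\sum_{x\in D}p(x)\log p(x)$. Given a joint distribution of $n$ random variables $X_1,\dots,X_n$ with finite domains, its entropic vector is $\bm h=(h(\alpha))_{\alpha\subseteq[n]}\in\mathbb R_+^{2^n}$, where $h(\alpha)=H((X_i)_{i\in\alpha})$ and $h(\emptyset)=0$. $\Gamma_n^*$ denotes the set of all entropic vectors and $\overline{\Gamma}_n^*$ its topological closure, the set of almost-entropic vectors. For $\bm c,\bm h\in\mathbb R^{2^n}$, $\bm c\cdot\bm h=\sum_{\alpha\subseteq[n]}c_\alpha h(\alpha)$. $\mathrm{AECIIP}$ is the decision problem: given integer vectors $\bm c_0,\bm c_1,\dots,\bm c_k\in\mathbb Z^{2^n}$, check whether $(\bm c_1\cdot\bm h\ge0\wedge\cdots\wedge\bm c_k\cdot\bm h\ge0)\Rightarrow\bm c_0\cdot\bm h\ge0$ holds for all $\bm h\in\overline{\Gamma}_n^*$. A vector $\bm c\in\mathbb R^{2^n}$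 is tight if $\bm c\cdot\bm h\le0$ for all $\bm h\in\overline{\Gamma}_n^*$. Inputs are encoded as natural numbers. $\Pi^0_3$ is the class of sets of the form $\{x\mid\forall y_1\exists y_2\forall y_3\,R(x,y_1,y_2,y_3)\}$ with $R$ a decidable predicate. A decision problem restricted to a class of inputs is in $\Pi^0_3$ if there is a set in $\Pi^0_3$ that contains an input of that class if and only if the answer to the problem on this input is yes. *)

theory Defs
  imports "HOL-Probability.Probability" "HOL-Library.Nat_Bijection"
begin

section \<open>Entropic and almost-entropic vectors\<close>

definition shannon_entropy :: "'a pmf \<Rightarrow> real" where
  "shannon_entropy p = - (\<Sum>x\<in>set_pmf p. pmf p x * log 2 (pmf p x))"

lemma shannon_entropy_conv_entropy:
  assumes "finite (set_pmf p)"
  shows "shannon_entropy p = prob_space.entropy (measure_pmf p) 2 (count_space UNIV) (\<lambda>x. x)"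
proof -
  have inf: "information_space (measure_pmf p) 2"
    by unfold_locales simp
  have "distributed (measure_pmf p) (count_space UNIV) (\<lambda>x. x) (\<lambda>x. ennreal (pmf p x))"
    by (simp add: distributed_def measure_pmf_eq_density[symmetric] distr_id2)
  then have "prob_space.entropy (measure_pmf p) 2 (count_space UNIV) (\<lambda>x. x)
      = - (LINT x|count_space UNIV. pmf p x * log 2 (pmf p x))"
    by (rule information_space.entropy_distr[OF inf]) simp
  also have "\<dots> = shannon_entropy p"
    unfolding shannon_entropy_def
    by (subst lebesgue_integral_count_space_finite_support)
      (auto intro!: finite_subset[OF _ assms] sum.mono_neutral_left assms simp: set_pmf_iff)
  finally show ?thesis by simp
qed

text \<open>
  The random variables \<open>X\<^sub>1, \<dots>, X\<^sub>n\<close> are indexed by \<open>{..<n}\<close>, and a joint distribution is a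
  distribution on tuples, i.e. on extensional functions on \<open>{..<n}\<close>. Since entropy does not
  depend on the names of the outcomes, the finite domains are taken to be sets of natural numbers.
\<close>

definition joint_distribution :: "nat \<Rightarrow> (nat \<Rightarrow> nat) pmf \<Rightarrow> bool" where
  "joint_distribution n p \<longleftrightarrow>
     (\<exists>D. (\<forall>i<n. finite (D i)) \<and> set_pmf p \<subseteq> (\<Pi>\<^sub>E i\<in>{..<n}. D i))"

definition entropic_vector :: "nat \<Rightarrow> (nat \<Rightarrow> nat) pmf \<Rightarrow> nat set \<Rightarrow> real" where
  "entropic_vector n p =
     (\<lambda>\<alpha>\<in>Pow {..<n}. shannon_entropy (map_pmf (\<lambda>x. restrict x \<alpha>) p))"

definition entropic :: "nat \<Rightarrow> (nat set \<Rightarrow> real) set" where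
  "entropic n = {entropic_vector n p | p. joint_distribution n p}"

text \<open>
  The space \<open>\<real>\<^bsup>2^n\<^esup>\<close> is the product of copies of the real line indexed by the subsets of \<open>{..<n}\<close>;
  its points are the functions that are undefined off \<open>Pow {..<n}\<close>.
\<close>

definition almost_entropic :: "nat \<Rightarrow> (nat set \<Rightarrow> real) set" where
  "almost_entropic n = powertop_real (Pow {..<n}) closure_of entropic n"

definition vec_dot :: "nat \<Rightarrow> (nat set \<Rightarrow> real) \<Rightarrow> (nat set \<Rightarrow> real) \<Rightarrow> real" where
  "vec_dot n c h = (\<Sum>\<alpha>\<in>Pow {..<n}. c \<alpha> * h \<alpha>)"

definition tight_vec :: "nat \<Rightarrow> (nat set \<Rightarrow> real) \<Rightarrow> bool" where
  "tight_vec n c \<longleftrightarrow> (\<forall>h\<in>almost_entropic n. vec_dot n c h \<le> 0)"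


section \<open>The decision problem and its inputs\<close>

text \<open>
  An input consists of \<open>n\<close>, the consequent \<open>c0\<close> and the list \<open>cs\<close> of antecedents. Only the
  values of the integer vectors on subsets of \<open>{..<n}\<close> matter.
\<close>

definition AECIIP :: "nat \<Rightarrow> (nat set \<Rightarrow> int) \<Rightarrow> (nat set \<Rightarrow> int) list \<Rightarrow> bool" where
  "AECIIP n c0 cs \<longleftrightarrow>
     (\<forall>h\<in>almost_entropic n.
        (\<forall>c\<in>set cs. vec_dot n (\<lambda>\<alpha>. of_int (c \<alpha>)) h \<ge> 0) \<longrightarrow>
        vec_dot n (\<lambda>\<alpha>. of_int (c0 \<alpha>)) h \<ge> 0)"

text \<open>
  The subsets of \<open>{..<n}\<close> are listed in the order of their characteristic bit strings, which are
  the binary representations of the numbers below \<open>2^n\<close>.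
\<close>

definition vec_encode :: "nat \<Rightarrow> (nat set \<Rightarrow> int) \<Rightarrow> nat" where
  "vec_encode n c = list_encode (map (\<lambda>m. int_encode (c (set_decode m))) [0..<2 ^ n])"

definition input_encode :: "nat \<Rightarrow> (nat set \<Rightarrow> int) \<Rightarrow> (nat set \<Rightarrow> int) list \<Rightarrow> nat" where
  "input_encode n c0 cs =
     prod_encode (n, prod_encode (vec_encode n c0, list_encode (map (vec_encode n) cs)))"

lemma vec_encode_eq_iff:
  "vec_encode n c = vec_encode n d \<longleftrightarrow> (\<forall>\<alpha>\<subseteq>{..<n}. c \<alpha> = d \<alpha>)"
proof -
  have img: "set_decode ` {..<2 ^ n} = Pow {..<n}"
  proof (intro equalityI subsetI)
    fix A assume A: "A \<in> Pow {..<n}"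
    then have fin: "finite A" using finite_subset by auto
    have "set_encode A \<le> set_encode {..<n}"
      using A unfolding set_encode_def by (intro sum_mono2) auto
    also have "set_encode {..<n} < 2 ^ n"
      by (induction n) (auto simp: set_encode_def lessThan_Suc)
    finally show "A \<in> set_decode ` {..<2 ^ n}"
      using fin by (metis image_eqI lessThan_iff set_encode_inverse)
  next
    fix A assume "A \<in> set_decode ` {..<2 ^ n}"
    then obtain m where m: "m < 2 ^ n" "A = set_decode m" by auto
    have "i < n" if "i \<in> A" for i
    proof (rule ccontr)
      assume "\<not> i < n"
      then have "m < 2 ^ i"
        using m(1) by (meson less_le_trans linorder_not_less one_le_numeral power_increasing)
      then show False using that m(2) by (simp add: set_decode_def)
    qed
    then show "A \<in> Pow {..<n}" by auto
  qed
  have "vec_encode n c = vec_encode n d \<longleftrightarrow>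
      (\<forall>\<alpha>\<in>set_decode ` {..<2 ^ n}. c \<alpha> = d \<alpha>)"
    by (auto simp: vec_encode_def list_encode_eq int_encode_eq)
  then show ?thesis unfolding img by auto
qed

lemma input_encode_eq_iff:
  "input_encode n c0 cs = input_encode n' d0 ds \<longleftrightarrow>
     n = n' \<and> (\<forall>\<alpha>\<subseteq>{..<n}. c0 \<alpha> = d0 \<alpha>) \<and>
     list_all2 (\<lambda>c d. \<forall>\<alpha>\<subseteq>{..<n}. c \<alpha> = d \<alpha>) cs ds"
proof -
  have "map (vec_encode n) cs = map (vec_encode n) ds \<longleftrightarrow>
      list_all2 (\<lambda>c d. \<forall>\<alpha>\<subseteq>{..<n}. c \<alpha> = d \<alpha>) cs ds"
    by (auto simp: list_eq_iff_nth_eq list_all2_conv_all_nth vec_encode_eq_iff)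
  then show ?thesis
    by (auto simp: input_encode_def vec_encode_eq_iff list_encode_eq)
qed


section \<open>Decidable predicates and the arithmetical class \<open>\<Pi>\<^sup>0\<^sub>3\<close>\<close>

text \<open>
  Kleene's general recursive functions of arity \<open>k\<close>, as functions on argument lists of
  length \<open>k\<close>; values on lists of another length carry no meaning. Minimisation is restricted to
  regular functions, so that exactly the total computable functions are generated.
\<close>

inductive recursive :: "nat \<Rightarrow> (nat list \<Rightarrow> nat) \<Rightarrow> bool" where
  zero: "recursive k (\<lambda>xs. 0)"
| succ: "recursive 1 (\<lambda>xs. Suc (xs ! 0))"
| proj: "i < k \<Longrightarrow> recursive k (\<lambda>xs. xs ! i)"
| comp: "recursive (length gs) f \<Longrightarrow> (\<forall>g\<in>set gs. recursive k g) \<Longrightarrow>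
    recursive k (\<lambda>xs. f (map (\<lambda>g. g xs) gs))"
| prec: "recursive k f \<Longrightarrow> recursive (k + 2) g \<Longrightarrow>
    recursive (k + 1) (\<lambda>xs. rec_nat (f (tl xs)) (\<lambda>m r. g (m # r # tl xs)) (hd xs))"
| minim: "recursive (k + 1) f \<Longrightarrow> (\<forall>xs. length xs = k \<longrightarrow> (\<exists>y. f (y # xs) = 0)) \<Longrightarrow>
    recursive k (\<lambda>xs. LEAST y. f (y # xs) = 0)"

definition decidable4 :: "(nat \<Rightarrow> nat \<Rightarrow> nat \<Rightarrow> nat \<Rightarrow> bool) \<Rightarrow> bool" where
  "decidable4 R \<longleftrightarrow>
     (\<exists>f. recursive 4 f \<and> (\<forall>x y1 y2 y3. f [x, y1, y2, y3] = (if R x y1 y2 y3 then 1 else 0)))"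

definition Pi_0_3 :: "nat set set" where
  "Pi_0_3 = {{x. \<forall>y1. \<exists>y2. \<forall>y3. R x y1 y2 y3} | R. decidable4 R}"

end

theory Submission
  imports Defs
begin

text \<open>
  Let \<open>g\<close> be the sum of the antecedents and \<open>f\<close> the consequent. By tightness \<open>g \<le> 0\<close> on almost-entropic
  vectors, and the antecedents hold exactly where \<open>g = 0\<close>. By compactness of the bounded parts
  \<open>h([n]) \<le> N\<close> of the set of almost-entropic vectors, the conditional inequality holds iff for every
  \<open>N\<close> there is a \<open>q\<close> with \<open>f h - q * g h + 1 / (N + 1) \<ge> 0\<close> for all \<open>h\<close> in a dense set with \<open>h([n]) \<le> N\<close>.
  Because \<open>h\<close> is only bounded and not normalised, it is not needed that the almost-entropic vectors
  form a cone.

  The dense set consists of the entropic vectors of the empirical distributions of \<open>M\<close> rows of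
  natural numbers. There \<open>h(\<alpha>)\<close> is the mean over the rows \<open>j\<close> of \<open>log (M / c)\<close>, with \<open>c\<close> the number of rows
  that agree with row \<open>j\<close> on \<open>\<alpha>\<close>. After exponentiation both inequalities compare products of
  powers of natural numbers, which is decidable.
\<close>

section \<open>Closure properties of the computable functions\<close>

named_theorems computable_intros

text \<open>Values of a \<open>recursive\<close> function on lists of the wrong length are artefacts
  of its construction. Demanding agreement only on length \<open>k\<close> allows a function to be
  replaced by any other that equals it there.\<close>

definition computable :: "nat \<Rightarrow> (nat list \<Rightarrow> nat) \<Rightarrow> bool" where
  "computable k F \<longleftrightarrow> (\<exists>f. recursive k f \<and> (\<forall>xs. length xs = k \<longrightarrow> f xs = F xs))"

lemma computable_cong:
  assumes "\<And>xs. length xs = k \<Longrightarrow> F xs = G xs"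
  shows "computable k F \<longleftrightarrow> computable k G"
  using assms by (auto simp: computable_def)

lemma computable_compose:
  assumes "computable (length gs) F" "\<And>g. g \<in> set gs \<Longrightarrow> computable k g"
  shows "computable k (\<lambda>xs. F (map (\<lambda>g. g xs) gs))"
proof -
  obtain f where f: "recursive (length gs) f" "\<And>xs. length xs = length gs \<Longrightarrow> f xs = F xs"
    using assms(1) by (auto simp: computable_def)
  have "\<forall>g\<in>set gs. \<exists>r. recursive k r \<and> (\<forall>xs. length xs = k \<longrightarrow> r xs = g xs)"
    using assms(2) by (auto simp: computable_def)
  then obtain r where
    r: "\<forall>g\<in>set gs. recursive k (r g) \<and> (\<forall>xs. length xs = k \<longrightarrow> r g xs = g xs)"
    by metis
  have "recursive k (\<lambda>xs. f (map (\<lambda>g. g xs) (map r gs)))"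
    using f(1) r by (intro recursive.comp) auto
  moreover have "f (map (\<lambda>g. g xs) (map r gs)) = F (map (\<lambda>g. g xs) gs)" if "length xs = k" for xs
  proof -
    have "map (\<lambda>g. g xs) (map r gs) = map (\<lambda>g. g xs) gs" using r that by auto
    then show ?thesis using f(2)[of "map (\<lambda>g. g xs) (map r gs)"] by (simp only: length_map)
  qed
  ultimately show ?thesis unfolding computable_def by blast
qed

lemma computable_compose1:
  assumes "computable 1 (\<lambda>xs. f (xs ! 0))" "computable k a"
  shows "computable k (\<lambda>xs. f (a xs))"
  using computable_compose[of "[a]" "\<lambda>xs. f (xs ! 0)" k] assms by simp

lemma computable_compose2:
  assumes "computable 2 (\<lambda>xs. f (xs ! 0) (xs ! 1))" "computable k a" "computable k b"
  shows "computable k (\<lambda>xs. f (a xs) (b xs))"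
  using computable_compose[of "[a, b]" "\<lambda>xs. f (xs ! 0) (xs ! 1)" k] assms
  by (auto simp: numeral_2_eq_2)

lemma computable_compose4:
  assumes "computable 4 (\<lambda>xs. f (xs ! 0) (xs ! 1) (xs ! 2) (xs ! 3))"
    "computable k a" "computable k b" "computable k c" "computable k d"
  shows "computable k (\<lambda>xs. f (a xs) (b xs) (c xs) (d xs))"
  using computable_compose[of "[a, b, c, d]" "\<lambda>xs. f (xs ! 0) (xs ! 1) (xs ! 2) (xs ! 3)" k] assms
  by (auto simp: eval_nat_numeral)

lemma computable_compose5:
  assumes "computable 5 (\<lambda>xs. f (xs ! 0) (xs ! 1) (xs ! 2) (xs ! 3) (xs ! 4))"
    "computable k a" "computable k b" "computable k c" "computable k d" "computable k e"
  shows "computable k (\<lambda>xs. f (a xs) (b xs) (c xs) (d xs) (e xs))"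
  using computable_compose[of "[a, b, c, d, e]"
      "\<lambda>xs. f (xs ! 0) (xs ! 1) (xs ! 2) (xs ! 3) (xs ! 4)" k] assms
  by (auto simp: eval_nat_numeral)

lemma computable_nth: "i < k \<Longrightarrow> computable k (\<lambda>xs. xs ! i)"
  by (auto simp: computable_def intro: recursive.proj)

text \<open>Every binder (a sum, product or bounded quantifier) puts its bound variable at the head
  of the argument list, so outer variables are read behind one \<open>tl\<close> per binder. Two
  levels cover all nestings below, and also a primitive recursion, which adds an index and an
  accumulator.\<close>

lemma computable_nth_tl:
  "Suc i < k \<Longrightarrow> computable k (\<lambda>xs. tl xs ! i)"
  "Suc (Suc i) < k \<Longrightarrow> computable k (\<lambda>xs. tl (tl xs) ! i)"
proof -
  show "computable k (\<lambda>xs. tl xs ! i)" if "Suc i < k"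
    using computable_nth[OF that] that
    by (subst computable_cong[where G = "\<lambda>xs. xs ! Suc i"]) (auto simp: nth_tl)
  show "computable k (\<lambda>xs. tl (tl xs) ! i)" if "Suc (Suc i) < k"
    using computable_nth[OF that] that
    by (subst computable_cong[where G = "\<lambda>xs. xs ! Suc (Suc i)"]) (auto simp: nth_tl)
qed

lemmas [computable_intros] = computable_nth computable_nth_tl

lemma computable_Suc [computable_intros]:
  "computable k a \<Longrightarrow> computable k (\<lambda>xs. Suc (a xs))"
  by (rule computable_compose1[where f = Suc])
    (use recursive.succ in \<open>auto simp: computable_def\<close>)

lemma computable_zero: "computable k (\<lambda>xs. 0)"
  using recursive.zero by (auto simp: computable_def)

lemma computable_const [computable_intros]: "computable k (\<lambda>xs. c)"
  by (induction c) (auto intro: computable_zero computable_Suc)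

text \<open>Turns a summand \<open>G i xs\<close> into a step function of a primitive recursion,
  where the accumulator stands between the index and the parameters.\<close>

lemma computable_drop_second:
  assumes "computable (Suc k) (\<lambda>ys. G (ys ! 0) (tl ys))"
  shows "computable (Suc (Suc k)) (\<lambda>ys. G (ys ! 0) (tl (tl ys)))"
proof -
  let ?gs = "(\<lambda>ys. ys ! 0) # map (\<lambda>i ys. ys ! Suc (Suc i)) [0..<k]"
  have "computable (Suc (Suc k))
      (\<lambda>ys. (\<lambda>ys. G (ys ! 0) (tl ys)) (map (\<lambda>g. g ys) ?gs))"
    using assms by (intro computable_compose) (auto intro!: computable_nth)
  moreover have "map ((\<lambda>g. g ys) \<circ> (\<lambda>i ys. ys ! Suc (Suc i))) [0..<k] = tl (tl ys)"
    if "length ys = Suc (Suc k)" for ys :: "nat list"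
    using that by (intro nth_equalityI) (auto simp: nth_tl)
  ultimately show ?thesis
    by (auto elim!: computable_cong[THEN iffD1, rotated])
qed

text \<open>\<open>recursive.prec\<close> recurses on the head and keeps the tail as parameters.
  Composing it with \<open>a\<close> followed by all \<open>k\<close> projections makes the
  recursion depth an arbitrary computable function of those parameters.\<close>

lemma computable_rec_nat:
  assumes "computable k a" "computable k b"
    "computable (Suc (Suc k)) (\<lambda>ys. G (ys ! 0) (ys ! 1) (tl (tl ys)))"
  shows "computable k (\<lambda>xs. rec_nat (b xs) (\<lambda>m r. G m r xs) (a xs))"
proof -
  obtain fb where fb: "recursive k fb" "\<And>xs. length xs = k \<Longrightarrow> fb xs = b xs"
    using assms(2) by (auto simp: computable_def)
  obtain fG where fG: "recursive (k + 2) fG"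
    "\<And>ys. length ys = Suc (Suc k) \<Longrightarrow> fG ys = G (ys ! 0) (ys ! 1) (tl (tl ys))"
    using assms(3) by (auto simp: computable_def)
  define H where "H = (\<lambda>xs. rec_nat (fb (tl xs)) (\<lambda>m r. fG (m # r # tl xs)) (hd xs))"
  let ?gs = "a # map (\<lambda>i xs. xs ! i) [0..<k]"
  have "recursive (k + 1) H" unfolding H_def by (intro recursive.prec fb fG)
  then have "computable k (\<lambda>xs. H (map (\<lambda>g. g xs) ?gs))"
    using assms(1)
    by (intro computable_compose) (auto simp: computable_def[of "Suc k"] intro!: computable_nth)
  moreover have "H (map (\<lambda>g. g xs) ?gs) = rec_nat (b xs) (\<lambda>m r. G m r xs) (a xs)"
    if "length xs = k" for xs
  proof -
    have "map ((\<lambda>g. g xs) \<circ> (\<lambda>i xs. xs ! i)) [0..<k] = xs"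
      using that by (intro nth_equalityI) auto
    moreover have "rec_nat (fb xs) (\<lambda>m r. fG (m # r # xs)) N = rec_nat (b xs) (\<lambda>m r. G m r xs) N" for N
      using that by (induction N) (auto simp: fb fG)
    ultimately show ?thesis by (simp add: H_def)
  qed
  ultimately show ?thesis by (auto elim!: computable_cong[THEN iffD1, rotated])
qed

section \<open>Arithmetic operations, finite sums and products by primitive recursion\<close>

lemma computable_add [computable_intros]:
  assumes "computable k a" "computable k b"
  shows "computable k (\<lambda>xs. a xs + b xs)"
proof (rule computable_compose2[where f = "(+)"])
  have "m + n = rec_nat m (\<lambda>_ r. Suc r) n" for m n :: nat by (induction n) auto
  then show "computable 2 (\<lambda>xs. xs ! 0 + xs ! 1)"
    by (simp only:) (intro computable_rec_nat computable_intros; simp)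
qed fact+

lemma computable_mult [computable_intros]:
  assumes "computable k a" "computable k b"
  shows "computable k (\<lambda>xs. a xs * b xs)"
proof (rule computable_compose2[where f = "(*)"])
  have "m * n = rec_nat 0 (\<lambda>_ r. r + m) n" for m n :: nat by (induction n) auto
  then show "computable 2 (\<lambda>xs. xs ! 0 * xs ! 1)"
    by (simp only:) (intro computable_rec_nat computable_intros; simp)
qed fact+

lemma computable_power [computable_intros]:
  assumes "computable k a" "computable k b"
  shows "computable k (\<lambda>xs. a xs ^ b xs)"
proof (rule computable_compose2[where f = "(^)"])
  have "m ^ n = rec_nat 1 (\<lambda>_ r. r * m) n" for m n :: nat by (induction n) auto
  then show "computable 2 (\<lambda>xs. xs ! 0 ^ xs ! 1)"
    by (simp only:) (intro computable_rec_nat computable_intros; simp)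
qed fact+

lemma computable_pred:
  assumes "computable k a"
  shows "computable k (\<lambda>xs. a xs - 1)"
proof (rule computable_compose1[where f = "\<lambda>m. m - 1"])
  have "m - 1 = rec_nat 0 (\<lambda>i _. i) m" for m :: nat by (induction m) auto
  then show "computable 1 (\<lambda>xs. xs ! 0 - 1)"
    by (simp only:) (intro computable_rec_nat computable_intros; simp)
qed fact+

lemma computable_diff [computable_intros]:
  assumes "computable k a" "computable k b"
  shows "computable k (\<lambda>xs. a xs - b xs)"
proof (rule computable_compose2[where f = "(-)"])
  have "m - n = rec_nat m (\<lambda>_ r. r - 1) n" for m n :: nat by (induction n) auto
  then have "(\<lambda>xs. xs ! 0 - xs ! 1 :: nat) = (\<lambda>xs. rec_nat (xs ! 0) (\<lambda>_ r. r - 1) (xs ! 1))"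
    by blast
  then show "computable 2 (\<lambda>xs. xs ! 0 - xs ! 1)"
    by (simp only:) (intro computable_rec_nat computable_pred computable_intros; simp)
qed fact+

lemma computable_sum [computable_intros]:
  assumes "computable k a" "computable (Suc k) (\<lambda>ys. G (ys ! 0) (tl ys))"
  shows "computable k (\<lambda>xs. \<Sum>i<a xs. G i xs)"
proof -
  have "(\<Sum>i<n. f i) = rec_nat 0 (\<lambda>i r. r + f i) n" for f :: "nat \<Rightarrow> nat" and n
    by (induction n) auto
  moreover have "computable (Suc (Suc k)) (\<lambda>ys. ys ! 1 + G (ys ! 0) (tl (tl ys)))"
    by (intro computable_intros computable_nth computable_drop_second[OF assms(2)]) simp
  ultimately show ?thesis
    by (simp only:) (intro computable_rec_nat computable_const assms(1))
qed

lemma computable_prod [computable_intros]: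
  assumes "computable k a" "computable (Suc k) (\<lambda>ys. G (ys ! 0) (tl ys))"
  shows "computable k (\<lambda>xs. \<Prod>i<a xs. G i xs)"
proof -
  have "(\<Prod>i<n. f i) = rec_nat 1 (\<lambda>i r. r * f i) n" for f :: "nat \<Rightarrow> nat" and n
    by (induction n) auto
  moreover have "computable (Suc (Suc k)) (\<lambda>ys. ys ! 1 * G (ys ! 0) (tl (tl ys)))"
    by (intro computable_intros computable_nth computable_drop_second[OF assms(2)]) simp
  ultimately show ?thesis
    by (simp only:) (intro computable_rec_nat computable_const assms(1))
qed

section \<open>Logical connectives, comparisons, bounded quantifiers and division through 0/1-valued
  functions\<close>

lemma computable_not [computable_intros]:
  assumes "computable k (\<lambda>xs. of_bool (P xs))"
  shows "computable k (\<lambda>xs. of_bool (\<not> P xs))"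
proof -
  have "of_bool (\<not> b) = (1 - of_bool b :: nat)" for b by simp
  then show ?thesis by (simp only:) (intro computable_intros assms)
qed

lemma computable_conj [computable_intros]:
  assumes "computable k (\<lambda>xs. of_bool (P xs))" "computable k (\<lambda>xs. of_bool (Q xs))"
  shows "computable k (\<lambda>xs. of_bool (P xs \<and> Q xs))"
  unfolding of_bool_conj by (intro computable_intros assms)

lemma computable_imp [computable_intros]:
  assumes "computable k (\<lambda>xs. of_bool (P xs))" "computable k (\<lambda>xs. of_bool (Q xs))"
  shows "computable k (\<lambda>xs. of_bool (P xs \<longrightarrow> Q xs))"
proof -
  have "(p \<longrightarrow> q) = (\<not> (p \<and> \<not> q))" for p q by blast
  then show ?thesis by (simp only:) (intro computable_intros assms)
qed

lemma computable_le [computable_intros]: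
  assumes "computable k a" "computable k b"
  shows "computable k (\<lambda>xs. of_bool (a xs \<le> b xs))"
proof -
  have "of_bool (m \<le> n) = (1 - (m - n))" for m n :: nat by simp
  then show ?thesis by (simp only:) (intro computable_intros assms)
qed

lemma computable_eq [computable_intros]:
  assumes "computable k a" "computable k b"
  shows "computable k (\<lambda>xs. of_bool (a xs = b xs))"
  unfolding eq_iff by (intro computable_intros assms)

lemma computable_ball [computable_intros]:
  assumes "computable k a" "computable (Suc k) (\<lambda>ys. of_bool (P (ys ! 0) (tl ys)))"
  shows "computable k (\<lambda>xs. of_bool (\<forall>i<a xs. P i xs))"
proof -
  have "of_bool (\<forall>i<n. p i) = (\<Prod>i<n. of_bool (p i) :: nat)" for p and n :: nat
    by (induction n) (auto simp: less_Suc_eq)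
  then show ?thesis by (simp only:) (intro computable_intros assms)
qed

lemma computable_div [computable_intros]:
  assumes "computable k a" "computable k b"
  shows "computable k (\<lambda>xs. a xs div b xs)"
proof (rule computable_compose2[where f = "(div)"])
  \<comment> \<open>The quotient counts the positive multiples \<open>Suc q * n\<close> up to
    \<open>m\<close>. For \<open>n = 0\<close> every \<open>q\<close> would be counted, so the
    leading factor restores \<open>m div 0 = 0\<close>.\<close>
  have "m div n = of_bool (\<not> n \<le> 0) * (\<Sum>q<m. of_bool (Suc q * n \<le> m))" for m n :: nat
  proof (cases "n = 0")
    case False
    have "(\<Sum>q<m. of_bool (Suc q * n \<le> m)) = card {q\<in>{..<m}. Suc q * n \<le> m}"
      by (simp add: of_bool_def sum.If_cases Int_def)
    also have "{q\<in>{..<m}. Suc q * n \<le> m} = {..<m div n}"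
    proof -
      have "Suc q * n \<le> m \<longleftrightarrow> q < m div n" for q
        using False by (metis Suc_le_eq less_eq_div_iff_mult_less_eq neq0_conv)
      then show ?thesis using div_le_dividend[of m n] by (auto intro: less_le_trans)
    qed
    finally show ?thesis using False by simp
  qed simp
  then show "computable 2 (\<lambda>xs. xs ! 0 div xs ! 1)"
    by (simp only:) (intro computable_intros; simp)
qed fact+

lemma computable_even [computable_intros]:
  assumes "computable k a"
  shows "computable k (\<lambda>xs. of_bool (even (a xs)))"
proof -
  have "even m \<longleftrightarrow> m = 2 * (m div 2)" for m :: nat by presburger
  then show ?thesis by (simp only:) (intro computable_intros assms)
qed

section \<open>Coded pairs and lists\<close>

definition pfst :: "nat \<Rightarrow> nat" where "pfst z = fst (prod_decode z)"
definition psnd :: "nat \<Rightarrow> nat" where "psnd z = snd (prod_decode z)"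

lemma pfst_prod_encode [simp]: "pfst (prod_encode (a, b)) = a"
  and psnd_prod_encode [simp]: "psnd (prod_encode (a, b)) = b"
  by (simp_all add: pfst_def psnd_def)

text \<open>Exactly one pair has code \<open>z\<close>, and both its components are at most
  \<open>z\<close>, so a bounded double sum finds it. Taking \<open>f\<close> to be a projection
  shows unpairing computable without minimisation.\<close>

lemma sum_prod_encode_eq:
  fixes f :: "nat \<Rightarrow> nat \<Rightarrow> nat"
  shows "(\<Sum>a<Suc z. \<Sum>b<Suc z. of_bool (prod_encode (a, b) = z) * f a b) = f (pfst z) (psnd z)"
proof -
  have z: "prod_encode (a, b) = z \<longleftrightarrow> a = pfst z \<and> b = psnd z" for a b
    by (metis pfst_def pfst_prod_encode prod.collapse prod_decode_inverse psnd_def psnd_prod_encode)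
  have le: "pfst z \<le> z" "psnd z \<le> z"
    unfolding pfst_def psnd_def
    by (metis le_prod_encode_1 prod.collapse prod_decode_inverse)
      (metis le_prod_encode_2 prod.collapse prod_decode_inverse)
  have "(\<Sum>b<Suc z. of_bool (a = pfst z \<and> b = psnd z) * f a b)
      = (\<Sum>b<Suc z. if b = psnd z then of_bool (a = pfst z) * f a b else 0)" for a
    by (intro sum.cong) auto
  also have "\<dots> a = (if a = pfst z then f a (psnd z) else 0)" for a
    using le(2) by (subst sum.delta) auto
  finally show ?thesis
    unfolding z using le(1) by (simp only:) (subst sum.delta; auto)
qed

lemma computable_prod_encode [computable_intros]:
  assumes "computable k a" "computable k b"
  shows "computable k (\<lambda>xs. prod_encode (a xs, b xs))"
  unfolding prod_encode_def triangle_def by (simp) (intro computable_intros assms)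

lemma computable_pfst [computable_intros]:
  assumes "computable k a"
  shows "computable k (\<lambda>xs. pfst (a xs))"
proof (rule computable_compose1[where f = pfst])
  show "computable 1 (\<lambda>xs. pfst (xs ! 0))"
    unfolding sum_prod_encode_eq[where f = "\<lambda>a b. a", symmetric] by (intro computable_intros; simp)
qed fact

lemma computable_psnd [computable_intros]:
  assumes "computable k a"
  shows "computable k (\<lambda>xs. psnd (a xs))"
proof (rule computable_compose1[where f = psnd])
  show "computable 1 (\<lambda>xs. psnd (xs ! 0))"
    unfolding sum_prod_encode_eq[where f = "\<lambda>a b. b", symmetric] by (intro computable_intros; simp)
qed fact

text \<open>Since \<^term>\<open>prod_decode 0 = (0, 0)\<close>, positions beyond the end of the list hold \<open>0\<close>.\<close>

definition lnth :: "nat \<Rightarrow> nat \<Rightarrow> nat" where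
  "lnth z i = pfst (rec_nat z (\<lambda>_ r. psnd (r - 1)) i - 1)"

lemma lnth_list_encode: "lnth (list_encode xs) i = (if i < length xs then xs ! i else 0)"
proof -
  have 0: "pfst 0 = 0" "psnd 0 = 0"
    using pfst_prod_encode[of 0 0] psnd_prod_encode[of 0 0] by (simp_all add: prod_encode_def)
  \<comment> \<open>Each round passes to the code of the tail: a nonempty list is coded by the
    successor of a pair code, hence \<open>r - 1\<close>. The empty list is a fixed point, as
    \<open>0 - 1 = 0\<close> and \<open>psnd 0 = 0\<close>.\<close>
  have "rec_nat (list_encode xs) (\<lambda>_ r. psnd (r - 1)) i = list_encode (drop i xs)"
  proof (induction i)
    case (Suc i)
    then show ?case
      by (cases "drop i xs") (auto simp: 0 drop_Suc drop_tl)
  qed simp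
  then show ?thesis
    unfolding lnth_def by (cases "drop i xs")
      (auto simp: 0 not_less dest: nth_via_drop)
qed

lemma lnth_0: "lnth 0 i = 0"
  using lnth_list_encode[of "[]" i] by simp

lemma computable_lnth [computable_intros]:
  assumes "computable k a" "computable k b"
  shows "computable k (\<lambda>xs. lnth (a xs) (b xs))"
proof (rule computable_compose2[where f = lnth])
  show "computable 2 (\<lambda>xs. lnth (xs ! 0) (xs ! 1))"
    unfolding lnth_def by (intro computable_rec_nat computable_intros; simp)
qed fact+

section \<open>The decidable matrix\<close>

text \<open>\<^const>\<open>int_encode\<close> sends \<open>k \<ge> 0\<close> to \<open>2 * k\<close> and \<open>k < 0\<close> to \<open>- 2 * k - 1\<close>.\<close>

definition pos_part :: "nat \<Rightarrow> nat" where "pos_part k = of_bool (even k) * (k div 2)"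
definition neg_part :: "nat \<Rightarrow> nat" where "neg_part k = of_bool (\<not> even k) * (Suc k div 2)"

lemma pos_part_neg_part_int_encode:
  "real (pos_part (int_encode k)) - real (neg_part (int_encode k)) = real_of_int k"
  by (auto simp: pos_part_def neg_part_def int_encode_def sum_encode_def)

lemma pos_part_0: "pos_part 0 = 0" and neg_part_0: "neg_part 0 = 0"
  by (simp_all add: pos_part_def neg_part_def)

lemma computable_pos_part [computable_intros]:
  "computable k a \<Longrightarrow> computable k (\<lambda>xs. pos_part (a xs))"
  unfolding pos_part_def by (intro computable_intros)

lemma computable_neg_part [computable_intros]:
  "computable k a \<Longrightarrow> computable k (\<lambda>xs. neg_part (a xs))"
  unfolding neg_part_def by (intro computable_intros)

text \<open>The number \<open>y\<close> codes a table as a list of rows, and the bits of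
  \<open>m\<close> select variables in the convention of \<open>set_decode\<close>.\<close>

definition agree_code :: "nat \<Rightarrow> nat \<Rightarrow> nat \<Rightarrow> nat \<Rightarrow> nat \<Rightarrow> nat" where
  "agree_code n M y m j =
    (\<Sum>i<M. of_bool (\<forall>v<n. \<not> even (m div 2 ^ v) \<longrightarrow> lnth (lnth y i) v = lnth (lnth y j) v))"

lemma computable_agree_code [computable_intros]:
  assumes "computable k a" "computable k b" "computable k c" "computable k d" "computable k e"
  shows "computable k (\<lambda>xs. agree_code (a xs) (b xs) (c xs) (d xs) (e xs))"
proof (rule computable_compose5[where f = agree_code])
  show "computable 5 (\<lambda>xs. agree_code (xs ! 0) (xs ! 1) (xs ! 2) (xs ! 3) (xs ! 4))"
    unfolding agree_code_def by (intro computable_intros; simp)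
qed fact+

text \<open>Their difference is the coefficient of \<open>c - q * (sum of cs)\<close>. The sum over \<open>l < cs\<close> covers the whole
  list, since a list is no longer than its code and \<^const>\<open>lnth\<close> is \<open>0\<close> past its end.\<close>

definition coeff_pos :: "nat \<Rightarrow> nat \<Rightarrow> nat \<Rightarrow> nat \<Rightarrow> nat" where
  "coeff_pos c cs q m = pos_part (lnth c m) + q * (\<Sum>l<cs. neg_part (lnth (lnth cs l) m))"

definition coeff_neg :: "nat \<Rightarrow> nat \<Rightarrow> nat \<Rightarrow> nat \<Rightarrow> nat" where
  "coeff_neg c cs q m = neg_part (lnth c m) + q * (\<Sum>l<cs. pos_part (lnth (lnth cs l) m))"

lemma computable_coeff_pos [computable_intros]:
  assumes "computable k a" "computable k b" "computable k c" "computable k d"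
  shows "computable k (\<lambda>xs. coeff_pos (a xs) (b xs) (c xs) (d xs))"
proof (rule computable_compose4[where f = coeff_pos])
  show "computable 4 (\<lambda>xs. coeff_pos (xs ! 0) (xs ! 1) (xs ! 2) (xs ! 3))"
    unfolding coeff_pos_def by (intro computable_intros; simp)
qed fact+

lemma computable_coeff_neg [computable_intros]:
  assumes "computable k a" "computable k b" "computable k c" "computable k d"
  shows "computable k (\<lambda>xs. coeff_neg (a xs) (b xs) (c xs) (d xs))"
proof (rule computable_compose4[where f = coeff_neg])
  show "computable 4 (\<lambda>xs. coeff_neg (xs ! 0) (xs ! 1) (xs ! 2) (xs ! 3))"
    unfolding coeff_neg_def by (intro computable_intros; simp)
qed fact+

text \<open>This is h([n]) \<le> \<open>N\<close>, multiplied by \<open>M\<close> and exponentiated.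
  The mask \<open>2 ^ n - 1\<close> selects all variables.\<close>

definition entropy_bounded :: "nat \<Rightarrow> nat \<Rightarrow> nat \<Rightarrow> nat \<Rightarrow> bool" where
  "entropy_bounded n N M y \<longleftrightarrow> M ^ M \<le> 2 ^ (N * M) * (\<Prod>j<M. agree_code n M y (2 ^ n - 1) j)"

text \<open>This is f h - q * g h + 1 / p \<ge> 0, multiplied by \<open>p * M\<close> and
  exponentiated; the slack 1 / p becomes \<open>2 ^ M\<close>. Splitting coefficients into positive
  and negative parts keeps all exponents natural numbers.\<close>

definition inequality_holds ::
    "nat \<Rightarrow> nat \<Rightarrow> nat \<Rightarrow> nat \<Rightarrow> nat \<Rightarrow> nat \<Rightarrow> nat \<Rightarrow> bool" where
  "inequality_holds n c cs p q M y \<longleftrightarrow>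
    (\<Prod>m<2 ^ n. \<Prod>j<M. M ^ (p * coeff_neg c cs q m) * agree_code n M y m j ^ (p * coeff_pos c cs q m))
    \<le> 2 ^ M *
    (\<Prod>m<2 ^ n. \<Prod>j<M. M ^ (p * coeff_pos c cs q m) * agree_code n M y m j ^ (p * coeff_neg c cs q m))"

text \<open>\<open>z\<close> pairs the number of rows minus one with a code of the rows, so the
  table is never empty. The single number \<open>N\<close> sets both the entropy bound and the
  tolerance 1 / (N + 1).\<close>

definition pi3_matrix :: "nat \<Rightarrow> nat \<Rightarrow> nat \<Rightarrow> nat \<Rightarrow> bool" where
  "pi3_matrix x N q z \<longleftrightarrow>
    (entropy_bounded (pfst x) N (Suc (pfst z)) (psnd z) \<longrightarrow>
     inequality_holds (pfst x) (pfst (psnd x)) (psnd (psnd x)) (Suc N) q (Suc (pfst z)) (psnd z))"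

lemma decidable4_pi3_matrix: "decidable4 pi3_matrix"
proof -
  have "computable 4 (\<lambda>xs. of_bool (pi3_matrix (xs ! 0) (xs ! 1) (xs ! 2) (xs ! 3)))"
    unfolding pi3_matrix_def entropy_bounded_def inequality_holds_def
    by (intro computable_intros; simp)
  then obtain f where "recursive 4 f"
    "\<And>xs. length xs = 4 \<Longrightarrow> f xs = of_bool (pi3_matrix (xs ! 0) (xs ! 1) (xs ! 2) (xs ! 3))"
    by (auto simp: computable_def)
  then show ?thesis
    unfolding decidable4_def by (intro exI[of _ f]) (auto simp: eval_nat_numeral)
qed

section \<open>Reduction to bounded vectors\<close>

text \<open>If no \<open>q\<close> works for some \<open>N\<close>, compactness yields one point
  that violates the inequality for all \<open>q\<close> at once; there g must vanish while f is
  negative. Conversely, a limit point with g = 0 and f < 0 has a neighbourhood on which the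
  inequality fails for large \<open>N\<close>, and this neighbourhood meets
  \<open>S\<close>.\<close>

lemma closure_implication_iff:
  fixes f g :: "('i \<Rightarrow> real) \<Rightarrow> real" and t :: 'i
  assumes S: "S \<subseteq> extensional I" and t: "t \<in> I"
    and bnd: "\<And>h i. h \<in> S \<Longrightarrow> i \<in> I \<Longrightarrow> 0 \<le> h i \<and> h i \<le> h t"
    and f: "continuous_map (powertop_real I) euclideanreal f"
    and g: "continuous_map (powertop_real I) euclideanreal g"
    and nonpos: "\<And>h. h \<in> powertop_real I closure_of S \<Longrightarrow> g h \<le> 0"
  shows "(\<forall>h\<in>powertop_real I closure_of S. 0 \<le> g h \<longrightarrow> 0 \<le> f h) \<longleftrightarrow>
    (\<forall>N. \<exists>q. \<forall>h\<in>S. h t \<le> real N \<longrightarrow> 0 \<le> f h - real q * g h + 1 / real (Suc N))"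
    (is "?L \<longleftrightarrow> ?R")
proof -
  let ?X = "powertop_real I"
  have S_X: "S \<subseteq> topspace ?X" using S by (auto simp: PiE_def)
  have proj: "continuous_map ?X euclideanreal (\<lambda>h. h i)" if "i \<in> I" for i
    using that by (rule continuous_map_product_projection)
  have comb: "continuous_map ?X euclideanreal (\<lambda>h. f h - real q * g h + 1 / real (Suc N))" for q N
    by (intro continuous_intros f g)
  show ?thesis
  proof
    assume L: ?L
    show ?R
    proof
      fix N
      show "\<exists>q. \<forall>h\<in>S. h t \<le> real N \<longrightarrow> 0 \<le> f h - real q * g h + 1 / real (Suc N)"
      proof (rule ccontr)
        assume neg: "\<not> ?thesis"
        define K where "K = ?X closure_of {h \<in> S. h t \<le> real N}"
        \<comment> \<open>The weak inequality makes \<open>A q\<close> closed; the positive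
          tolerance still forces f h < 0 on \<open>A 0\<close>.\<close>
        define A where "A q = {h \<in> K. f h - real q * g h + 1 / real (Suc N) \<le> 0}" for q
        have K_sub: "K \<subseteq> ?X closure_of S" unfolding K_def by (rule closure_of_mono) auto
        \<comment> \<open>The coordinate \<open>t\<close> dominates all others, so \<open>K\<close>
          lies in a product of intervals, compact by Tychonoff's theorem.\<close>
        have "K \<subseteq> (\<Pi>\<^sub>E i\<in>I. {0..real N})"
          unfolding K_def
        proof (rule closure_of_minimal)
          show "{h \<in> S. h t \<le> real N} \<subseteq> (\<Pi>\<^sub>E i\<in>I. {0..real N})"
            using S bnd by (force simp: PiE_def)
          show "closedin ?X (\<Pi>\<^sub>E i\<in>I. {0..real N})"
            by (simp add: closedin_product_topology)
        qed
        moreover have "compactin ?X (\<Pi>\<^sub>E i\<in>I. {0..real N})"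
          by (simp add: compactin_PiE)
        moreover have "closedin ?X K" by (simp add: K_def)
        ultimately have "compactin ?X K"
          using closed_compactin by blast
        moreover have "closedin ?X (A q)" for q
        proof -
          have "A q = K \<inter> {h \<in> topspace ?X. f h - real q * g h + 1 / real (Suc N) \<in> {..0}}"
            using closure_of_subset_topspace[of ?X] by (auto simp: A_def K_def)
          moreover have "closedin ?X {h \<in> topspace ?X. f h - real q * g h + 1 / real (Suc N) \<in> {..0}}"
            by (rule closedin_continuous_map_preimage[OF comb]) simp
          ultimately show ?thesis by (simp only: K_def closedin_Int closedin_closure_of)
        qed
        moreover have "K \<inter> \<Inter>\<F> \<noteq> {}" if "finite \<F>" "\<F> \<subseteq> range A" for \<F>
        proof -
          obtain Q where Q: "finite Q" "\<F> = A ` Q" using \<open>finite \<F>\<close> \<open>\<F> \<subseteq> range A\<close> by (metis finite_subset_image)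
          \<comment> \<open>As g \<le> 0, the expression f h - q * g h grows with \<open>q\<close>.
            A violation at an upper bound of \<open>Q\<close> is thus a violation at each of its
            elements; the sum is an upper bound that also makes sense for empty
            \<open>Q\<close>.\<close>
          obtain h where h: "h \<in> S" "h t \<le> real N" "f h - real (\<Sum>Q) * g h + 1 / real (Suc N) < 0"
            using neg by (meson not_le)
          have hK: "h \<in> K"
            using h S_X closure_of_subset[of "{h \<in> S. h t \<le> real N}" ?X] by (auto simp: K_def)
          have "h \<in> A q" if "q \<in> Q" for q
          proof -
            have "real q \<le> real (\<Sum>Q)" using that Q by (simp add: member_le_sum)
            then have "real (\<Sum>Q) * g h \<le> real q * g h"
              using nonpos[of h] hK K_sub by (intro mult_right_mono_neg) auto
            then show ?thesis using h hK by (simp add: A_def)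
          qed
          then show ?thesis using hK Q by auto
        qed
        ultimately have "K \<inter> \<Inter>(range A) \<noteq> {}" unfolding compactin_fip by blast
        then obtain h where hK: "h \<in> K" and h: "\<And>q. f h - real q * g h + 1 / real (Suc N) \<le> 0"
          by (auto simp: A_def)
        have pos: "0 < 1 / real (Suc N)" by simp
        have "0 \<le> g h"
        proof (rule ccontr)
          assume "\<not> 0 \<le> g h"
          then obtain q where "- f h < real q * - g h"
            using reals_Archimedean3[of "- g h"] by (meson neg_0_less_iff_less not_le)
          with h[of q] pos show False by linarith
        qed
        then have "0 \<le> f h" using L hK K_sub by blast
        then show False using h[of 0] pos by simp
      qed
    qed
  next
    assume R: ?R
    show ?L
    proof (intro ballI impI)
      fix h assume h: "h \<in> ?X closure_of S" "0 \<le> g h"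
      then have gh: "g h = 0" using nonpos by force
      show "0 \<le> f h"
      proof (rule ccontr)
        assume neg: "\<not> 0 \<le> f h"
        then obtain N1 where N1: "1 / real (Suc N1) < - f h"
          using nat_approx_posE[of "- f h"] by auto
        obtain N2 where N2: "h t < real N2" using reals_Archimedean2 by blast
        \<comment> \<open>One \<open>N\<close> has to make the tolerance smaller than - f h and also
          exceed the coordinate h t.\<close>
        define N where "N = max N1 N2"
        have N: "1 / real (Suc N) < - f h" "h t < real N"
        proof -
          have "1 / real (Suc N) \<le> 1 / real (Suc N1)" by (simp add: N_def frac_le)
          then show "1 / real (Suc N) < - f h" using N1 by simp
        qed (use N2 in \<open>auto simp: N_def\<close>)
        obtain q where q: "\<And>h. h \<in> S \<Longrightarrow> h t \<le> real N \<Longrightarrow> 0 \<le> f h - real q * g h + 1 / real (Suc N)"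
          using R by blast
        \<comment> \<open>Both conditions are strict, so \<open>T\<close> is open. At
          \<open>h\<close> itself g vanishes, so the second one holds there for whichever
          \<open>q\<close> was supplied.\<close>
        define T where "T = {h \<in> topspace ?X. h t \<in> {..<real N}} \<inter>
          {h \<in> topspace ?X. f h - real q * g h + 1 / real (Suc N) \<in> {..<0}}"
        have "openin ?X T"
          unfolding T_def
          by (intro openin_Int openin_continuous_map_preimage[OF comb]
              openin_continuous_map_preimage[OF proj[OF t]]) auto
        moreover have "h \<in> T"
          using N gh h(1) closure_of_subset_topspace[of ?X S] by (auto simp: T_def)
        ultimately obtain h' where "h' \<in> S" "h' \<in> T"
          using h(1) by (auto simp: in_closure_of)
        then show False using q[of h'] by (auto simp: T_def)
      qed
    qed
  qed
qed

lemma continuous_map_vec_dot: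
  "continuous_map (powertop_real (Pow {..<n})) euclideanreal (vec_dot n c)"
  unfolding vec_dot_def
  by (intro continuous_map_sum continuous_map_real_mult continuous_map_const[THEN iffD2])
    (auto intro: continuous_map_product_projection)

section \<open>Empirical distributions are dense\<close>

text \<open>A value with a fibre of c indices among M has probability c / M. Its entropy term splits
  into c equal terms log(M / c) / M, one per index of the fibre.\<close>

lemma shannon_entropy_map_uniform:
  assumes A: "finite A" "A \<noteq> {}"
  shows "shannon_entropy (map_pmf g (pmf_of_set A)) =
    (\<Sum>j\<in>A. log 2 (real (card A) / real (card {i \<in> A. g i = g j}))) / real (card A)"
proof -
  define c where "c z = real (card {i \<in> A. g i = z})" for z
  define M where "M = real (card A)"
  have M: "M > 0" using A by (simp add: M_def card_gt_0_iff)
  have c: "c (g j) > 0" if "j \<in> A" for j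
    using A that by (auto simp: c_def card_gt_0_iff)
  have pmf: "pmf (map_pmf g (pmf_of_set A)) z = c z / M" for z
  proof -
    have "A \<inter> g -` {z} = {i \<in> A. g i = z}" by auto
    then show ?thesis
      using A by (simp add: pmf_map measure_pmf_of_set c_def M_def)
  qed
  have "shannon_entropy (map_pmf g (pmf_of_set A)) = - (\<Sum>z\<in>g ` A. c z / M * log 2 (c z / M))"
    using A by (simp add: shannon_entropy_def pmf)
  also have "\<dots> = (\<Sum>z\<in>g ` A. \<Sum>j\<in>{j\<in>A. g j = z}. log 2 (M / c (g j)) / M)"
    unfolding sum_negf[symmetric]
  proof (intro sum.cong refl)
    fix z assume "z \<in> g ` A"
    then have "c z > 0" using c by auto
    then have "- (c z / M * log 2 (c z / M)) = c z * (log 2 (M / c z) / M)"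
      using M by (simp add: log_divide field_simps)
    also have "\<dots> = (\<Sum>j\<in>{j\<in>A. g j = z}. log 2 (M / c (g j)) / M)"
      by (simp add: c_def)
    finally show "- (c z / M * log 2 (c z / M)) = (\<Sum>j\<in>{j\<in>A. g j = z}. log 2 (M / c (g j)) / M)" .
  qed
  also have "\<dots> = (\<Sum>j\<in>A. log 2 (M / c (g j)) / M)"
    using A by (intro sum.image_gen[symmetric])
  finally show ?thesis by (simp add: c_def M_def sum_divide_distrib)
qed

section \<open>Continuity of entropy over a fixed finite support\<close>

lemma pmf_map_finite_support:
  assumes "finite X" "set_pmf p \<subseteq> X"
  shows "pmf (map_pmf g p) z = (\<Sum>x | x \<in> X \<and> g x = z. pmf p x)"
proof -
  have "pmf (map_pmf g p) z = measure p (g -` {z} \<inter> set_pmf p)"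
    by (simp add: pmf_map measure_Int_set_pmf)
  also have "g -` {z} \<inter> set_pmf p = {x \<in> X. g x = z} \<inter> set_pmf p"
    using assms by auto
  also have "measure p \<dots> = measure p {x \<in> X. g x = z}"
    by (simp add: measure_Int_set_pmf)
  also have "\<dots> = (\<Sum>x | x \<in> X \<and> g x = z. pmf p x)"
    using assms by (simp add: measure_measure_pmf_finite)
  finally show ?thesis .
qed

lemma shannon_entropy_superset:
  assumes "finite Z" "set_pmf p \<subseteq> Z"
  shows "shannon_entropy p = - (\<Sum>z\<in>Z. pmf p z * log 2 (pmf p z))"
  unfolding shannon_entropy_def using assms
  by (intro arg_cong[where f = uminus] sum.mono_neutral_left) (auto simp: set_pmf_iff)

lemma tendsto_shannon_entropy_map:
  assumes fin: "finite (set_pmf p)" and supp: "\<And>k. set_pmf (q k) \<subseteq> set_pmf p"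
    and lim: "\<And>x. x \<in> set_pmf p \<Longrightarrow> (\<lambda>k. pmf (q k) x) \<longlonglongrightarrow> pmf p x"
  shows "(\<lambda>k. shannon_entropy (map_pmf g (q k))) \<longlonglongrightarrow> shannon_entropy (map_pmf g p)"
proof -
  let ?Z = "g ` set_pmf p"
  have lim': "(\<lambda>k. pmf (map_pmf g (q k)) z) \<longlonglongrightarrow> pmf (map_pmf g p) z" for z
    unfolding pmf_map_finite_support[OF fin supp] pmf_map_finite_support[OF fin order.refl]
    by (intro tendsto_sum lim) auto
  \<comment> \<open>Every z in \<open>?Z\<close> has positive limiting mass, so the logarithm is
    continuous at the limit. The inclusion of supports lets the same index set serve all
    \<open>k\<close>.\<close>
  have "(\<lambda>k. - (\<Sum>z\<in>?Z. pmf (map_pmf g (q k)) z * log 2 (pmf (map_pmf g (q k)) z)))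
      \<longlonglongrightarrow> - (\<Sum>z\<in>?Z. pmf (map_pmf g p) z * log 2 (pmf (map_pmf g p) z))"
    by (intro tendsto_intros lim') (auto simp: set_pmf_iff[symmetric])
  moreover have "shannon_entropy (map_pmf g (q k))
      = - (\<Sum>z\<in>?Z. pmf (map_pmf g (q k)) z * log 2 (pmf (map_pmf g (q k)) z))" for k
    using fin supp[of k] by (intro shannon_entropy_superset) auto
  moreover have "shannon_entropy (map_pmf g p)
      = - (\<Sum>z\<in>?Z. pmf (map_pmf g p) z * log 2 (pmf (map_pmf g p) z))"
    using fin by (intro shannon_entropy_superset) auto
  ultimately show ?thesis by simp
qed

section \<open>Empirical distributions: a uniformly drawn row of a finite table\<close>

definition empirical :: "nat \<Rightarrow> nat \<Rightarrow> (nat \<Rightarrow> nat \<Rightarrow> nat) \<Rightarrow> (nat \<Rightarrow> nat) pmf" where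
  "empirical n M e = map_pmf (\<lambda>i. \<lambda>v\<in>{..<n}. e i v) (pmf_of_set {..<M})"

definition empirical_vectors :: "nat \<Rightarrow> (nat set \<Rightarrow> real) set" where
  "empirical_vectors n = {entropic_vector n (empirical n M e) | M e. M > 0}"

definition agree_count :: "nat \<Rightarrow> (nat \<Rightarrow> nat \<Rightarrow> nat) \<Rightarrow> nat set \<Rightarrow> nat \<Rightarrow> nat" where
  "agree_count M e \<alpha> j = card {i. i < M \<and> (\<forall>v\<in>\<alpha>. e i v = e j v)}"

lemma entropic_vector_empirical:
  assumes "M > 0" "\<alpha> \<subseteq> {..<n}"
  shows "entropic_vector n (empirical n M e) \<alpha> =
    (\<Sum>j<M. log 2 (real M / real (agree_count M e \<alpha> j))) / real M"
proof -
  let ?g = "\<lambda>i. restrict (\<lambda>v\<in>{..<n}. e i v) \<alpha>"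
  have "?g i = ?g j \<longleftrightarrow> (\<forall>v\<in>\<alpha>. e i v = e j v)" for i j
    using assms(2) by (auto simp: fun_eq_iff restrict_def subset_iff)
  then have "{i \<in> {..<M}. ?g i = ?g j} = {i. i < M \<and> (\<forall>v\<in>\<alpha>. e i v = e j v)}" for j
    by auto
  then show ?thesis
    using assms shannon_entropy_map_uniform[of "{..<M}" ?g]
    by (simp add: entropic_vector_def empirical_def map_pmf_comp agree_count_def lessThan_empty_iff)
qed

lemma agree_count_bounds:
  assumes "j < M"
  shows "0 < agree_count M e \<alpha> j" "agree_count M e \<alpha> j \<le> M"
proof -
  show "0 < agree_count M e \<alpha> j"
    using assms by (auto simp: agree_count_def card_gt_0_iff)
  have "agree_count M e \<alpha> j \<le> card {..<M}"
    unfolding agree_count_def by (intro card_mono) auto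
  then show "agree_count M e \<alpha> j \<le> M" by simp
qed

lemma agree_count_antimono: "\<alpha> \<subseteq> \<beta> \<Longrightarrow> agree_count M e \<beta> j \<le> agree_count M e \<alpha> j"
  unfolding agree_count_def by (intro card_mono) auto

text \<open>Both bounds hold row by row: an agreement count lies between 1 and \<open>M\<close>, and
  it can only shrink when more variables have to agree.\<close>

lemma empirical_vectors_bounds:
  assumes "h \<in> empirical_vectors n" "\<alpha> \<in> Pow {..<n}"
  shows "0 \<le> h \<alpha> \<and> h \<alpha> \<le> h {..<n}"
proof -
  obtain M e where M: "M > 0" and h: "h = entropic_vector n (empirical n M e)"
    using assms(1) by (auto simp: empirical_vectors_def)
  have \<alpha>: "\<alpha> \<subseteq> {..<n}" using assms(2) by auto
  have "0 \<le> log 2 (real M / real (agree_count M e \<alpha> j))"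
    "log 2 (real M / real (agree_count M e \<alpha> j)) \<le> log 2 (real M / real (agree_count M e {..<n} j))"
    if "j < M" for j
    using agree_count_bounds[OF that] agree_count_antimono[OF \<alpha>, of M e j] M
    by (auto simp: divide_simps zero_le_log_cancel_iff)
  then show ?thesis
    unfolding h entropic_vector_empirical[OF M \<alpha>] entropic_vector_empirical[OF M order.refl]
    by (intro conjI divide_nonneg_nonneg divide_right_mono sum_nonneg sum_mono) auto
qed

lemma empirical_vectors_entropic: "empirical_vectors n \<subseteq> entropic n"
proof -
  have "joint_distribution n (empirical n M e)" if "M > 0" for M e
    using that unfolding joint_distribution_def empirical_def
    by (intro exI[of _ "\<lambda>v. (\<lambda>i. e i v) ` {..<M}"]) (auto simp: lessThan_empty_iff split: if_splits)
  then show ?thesis by (auto simp: empirical_vectors_def entropic_def)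
qed

text \<open>Enumerating the disjoint union of blocks of size \<open>a x\<close> and projecting to
  the block label realises the weights as multiplicities of a uniform draw.\<close>

lemma uniform_map_with_fibres:
  fixes a :: "'b \<Rightarrow> nat"
  assumes X: "finite X" and pos: "0 < (\<Sum>x\<in>X. a x)"
  obtains r :: "nat \<Rightarrow> 'b" where "r ` {..<\<Sum>x\<in>X. a x} \<subseteq> X"
    "\<And>x. x \<in> X \<Longrightarrow> pmf (map_pmf r (pmf_of_set {..<\<Sum>x\<in>X. a x})) x = a x / (\<Sum>x\<in>X. a x)"
proof -
  define M where "M = (\<Sum>x\<in>X. a x)"
  let ?P = "SIGMA x:X. {..<a x}"
  have "card ?P = M" using X by (simp add: M_def)
  moreover have "finite ?P" using X by auto
  ultimately obtain b where b: "bij_betw b {..<M} ?P"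
    using ex_bij_betw_nat_finite[of ?P] by (auto simp: atLeast0LessThan)
  define r where "r = fst \<circ> b"
  have "fst z \<in> X" if "z \<in> ?P" for z using that by auto
  then have "r ` {..<M} \<subseteq> X" using bij_betwE[OF b] by (metis comp_apply image_subsetI r_def)
  moreover have "pmf (map_pmf r (pmf_of_set {..<M})) x = a x / M" if "x \<in> X" for x
  proof -
    have "b ` ({..<M} \<inter> r -` {x}) = {z \<in> b ` {..<M}. fst z = x}"
      by (auto simp: r_def)
    also have "\<dots> = {x} \<times> {..<a x}"
      using that unfolding bij_betw_imp_surj_on[OF b] by auto
    finally have "bij_betw b ({..<M} \<inter> r -` {x}) ({x} \<times> {..<a x})"
      by (intro bij_betw_subset[OF b]) auto
    then have "card ({..<M} \<inter> r -` {x}) = a x"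
      by (simp add: bij_betw_same_card)
    then show ?thesis
      using pos by (simp add: pmf_map measure_pmf_of_set M_def lessThan_empty_iff)
  qed
  ultimately show ?thesis using that by (simp add: M_def)
qed

text \<open>Rounding the weights \<open>k * p x\<close> down to integers and renormalising keeps the support finite
  and fixed, so all entropies converge.\<close>

lemma entropic_closure_empirical:
  "entropic n \<subseteq> powertop_real (Pow {..<n}) closure_of empirical_vectors n"
proof
  let ?X = "powertop_real (Pow {..<n})"
  fix h assume "h \<in> entropic n"
  then obtain p D where h: "h = entropic_vector n p" and D: "\<And>i. i < n \<Longrightarrow> finite (D i)"
    and pD: "set_pmf p \<subseteq> (\<Pi>\<^sub>E i\<in>{..<n}. D i)"
    by (auto simp: entropic_def joint_distribution_def)
  have fin: "finite (set_pmf p)"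
    using D by (intro finite_subset[OF pD] finite_PiE) auto
  define a where "a k x = nat \<lfloor>real k * pmf p x\<rfloor>" for k x
  define A where "A k = (\<Sum>x\<in>set_pmf p. a k x)" for k
  have lim_a: "(\<lambda>k. a k x / k) \<longlonglongrightarrow> pmf p x" for x
  proof (rule tendsto_sandwich)
    show "\<forall>\<^sub>F k in sequentially. pmf p x - 1 / k \<le> a k x / k"
      using eventually_gt_at_top[of 0]
    proof eventually_elim
      case (elim k)
      have "real k * pmf p x - 1 \<le> real (a k x)" unfolding a_def by linarith
      then have "(real k * pmf p x - 1) / k \<le> a k x / k" by (rule divide_right_mono) simp
      then show ?case using elim by (simp add: diff_divide_distrib)
    qed
    show "\<forall>\<^sub>F k in sequentially. a k x / k \<le> pmf p x"
      using eventually_gt_at_top[of 0]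
    proof eventually_elim
      case (elim k)
      have "real (a k x) \<le> real k * pmf p x" unfolding a_def by simp
      then show ?case using elim by (simp add: field_simps)
    qed
    show "(\<lambda>k. pmf p x - 1 / real k) \<longlonglongrightarrow> pmf p x"
      using tendsto_diff[OF tendsto_const lim_1_over_n] by simp
  qed simp
  have lim_A: "(\<lambda>k. A k / k) \<longlonglongrightarrow> 1"
  proof -
    have "(\<lambda>k. \<Sum>x\<in>set_pmf p. a k x / k) \<longlonglongrightarrow> (\<Sum>x\<in>set_pmf p. pmf p x)"
      by (intro tendsto_sum lim_a)
    then show ?thesis using fin
      by (simp add: A_def sum_divide_distrib sum_pmf_eq_1)
  qed
  have "\<forall>\<^sub>F k in sequentially. A k / k > 0"
    using order_tendstoD(1)[OF lim_A] by simp
  then have "\<forall>\<^sub>F k in sequentially. A k > 0"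
    by eventually_elim (auto intro: Nat.gr0I)
  \<comment> \<open>For small \<open>k\<close> all rounded weights may be 0, leaving nothing to draw
    from; the sequence is therefore shifted by \<open>k0\<close>.\<close>
  then obtain k0 where k0: "\<And>k. k \<ge> k0 \<Longrightarrow> A k > 0"
    by (auto simp: eventually_sequentially)
  have "\<exists>r. r ` {..<A (k + k0)} \<subseteq> set_pmf p \<and>
      (\<forall>x\<in>set_pmf p. pmf (map_pmf r (pmf_of_set {..<A (k + k0)})) x = a (k + k0) x / A (k + k0))" for k
    using uniform_map_with_fibres[OF fin, of "a (k + k0)"] k0[of "k + k0"] unfolding A_def
    by (metis le_add2)
  then obtain r where r: "\<And>k. r k ` {..<A (k + k0)} \<subseteq> set_pmf p"
    "\<And>k x. x \<in> set_pmf p \<Longrightarrow>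
      pmf (map_pmf (r k) (pmf_of_set {..<A (k + k0)})) x = a (k + k0) x / A (k + k0)"
    by metis
  \<comment> \<open>The support of \<open>p\<close> consists of functions already undefined off
    \<open>{..<n}\<close>, so the restriction in \<open>empirical\<close> leaves the rows
    unchanged.\<close>
  have emp: "map_pmf (r k) (pmf_of_set {..<A (k + k0)}) = empirical n (A (k + k0)) (r k)" for k
    unfolding empirical_def
  proof (rule map_pmf_cong[OF refl])
    fix i assume "i \<in> set_pmf (pmf_of_set {..<A (k + k0)})"
    then have "r k i \<in> (\<Pi>\<^sub>E i\<in>{..<n}. D i)"
      using r(1)[of k] pD k0[of "k + k0"] by (auto simp: lessThan_empty_iff)
    then show "r k i = (\<lambda>v\<in>{..<n}. r k i v)"
      by (auto simp: PiE_def extensional_restrict)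
  qed
  define q where "q k = empirical n (A (k + k0)) (r k)" for k
  have lim_q: "(\<lambda>k. pmf (q k) x) \<longlonglongrightarrow> pmf p x" if "x \<in> set_pmf p" for x
  proof -
    \<comment> \<open>The mass a / A is written as (a / k) / (A / k), whose parts tend to
      \<open>pmf p x\<close> and 1. Cancelling the common denominator needs k + k0 > 0, true
      eventually.\<close>
    have "(\<lambda>k. (a (k + k0) x / real (k + k0)) / (A (k + k0) / real (k + k0))) \<longlonglongrightarrow> pmf p x / 1"
      by (intro tendsto_divide LIMSEQ_ignore_initial_segment[OF lim_a]
          LIMSEQ_ignore_initial_segment[OF lim_A]) simp
    moreover have "\<forall>\<^sub>F k in sequentially.
        (a (k + k0) x / real (k + k0)) / (A (k + k0) / real (k + k0)) = pmf (q k) x"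
      using eventually_gt_at_top[of 0]
      by eventually_elim (simp add: q_def emp[symmetric] r(2)[OF that])
    ultimately show ?thesis by (simp add: Lim_transform_eventually)
  qed
  have supp: "set_pmf (q k) \<subseteq> set_pmf p" for k
    using r(1)[of k] k0[of "k + k0"] by (simp add: q_def emp[symmetric] lessThan_empty_iff)
  have "limitin ?X (\<lambda>k. entropic_vector n (q k)) h sequentially"
    unfolding limitin_componentwise
  proof (intro conjI ballI)
    show "h \<in> extensional (Pow {..<n})"
      by (simp add: h entropic_vector_def)
    show "\<forall>\<^sub>F k in sequentially. entropic_vector n (q k) \<in> topspace ?X"
      by (simp add: entropic_vector_def)
    fix \<alpha> assume "\<alpha> \<in> Pow {..<n}"
    then show "limitin euclideanreal (\<lambda>k. entropic_vector n (q k) \<alpha>) (h \<alpha>) sequentially"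
      using tendsto_shannon_entropy_map[OF fin supp lim_q] by (simp add: h entropic_vector_def)
  qed
  moreover have "entropic_vector n (q k) \<in> empirical_vectors n" for k
    using k0[of "k + k0"] by (auto simp: q_def empirical_vectors_def)
  ultimately show "h \<in> ?X closure_of empirical_vectors n"
    unfolding in_closure_of limitin_def by (metis (lifting) eventually_sequentially order.refl)
qed

lemma almost_entropic_eq_closure_empirical:
  "almost_entropic n = powertop_real (Pow {..<n}) closure_of empirical_vectors n"
proof (rule subset_antisym)
  show "almost_entropic n \<subseteq> powertop_real (Pow {..<n}) closure_of empirical_vectors n"
    unfolding almost_entropic_def
    by (rule closure_of_minimal[OF entropic_closure_empirical closedin_closure_of])
  show "powertop_real (Pow {..<n}) closure_of empirical_vectors n \<subseteq> almost_entropic n"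
    unfolding almost_entropic_def by (rule closure_of_mono[OF empirical_vectors_entropic])
qed

section \<open>Linear inequalities between logarithms as integer inequalities\<close>

lemma nat_le_iff_log_le: "0 < a \<Longrightarrow> 0 < b \<Longrightarrow> a \<le> b \<longleftrightarrow> log 2 (real a) \<le> log 2 (real b)"
  by simp

lemma log_prod:
  fixes f :: "'a \<Rightarrow> real"
  assumes "\<And>i. i \<in> I \<Longrightarrow> 0 < f i"
  shows "log b (prod f I) = (\<Sum>i\<in>I. log b (f i))"
  using assms
proof (induction I rule: infinite_finite_induct)
  case (insert i I)
  then have "0 < f i" "0 < prod f I" by (auto intro: prod_pos)
  then have "log b (f i * prod f I) = log b (f i) + log b (prod f I)" by (rule log_mult_pos)
  then show ?case using insert by simp
qed auto

lemma prod_power_le_iff_log: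
  fixes c :: "'m \<Rightarrow> nat \<Rightarrow> nat" and P N :: "'m \<Rightarrow> nat"
  assumes M: "M > 0" and p: "p > 0" and c: "\<And>m j. m \<in> I \<Longrightarrow> j < M \<Longrightarrow> c m j > 0"
  shows "(\<Prod>m\<in>I. \<Prod>j<M. M ^ (p * N m) * c m j ^ (p * P m))
      \<le> 2 ^ M * (\<Prod>m\<in>I. \<Prod>j<M. M ^ (p * P m) * c m j ^ (p * N m)) \<longleftrightarrow>
    0 \<le> (\<Sum>m\<in>I. (real (P m) - real (N m)) * ((\<Sum>j<M. log 2 (real M / real (c m j))) / real M))
      + 1 / real p" (is "?A \<le> ?B \<longleftrightarrow> 0 \<le> ?S + _")
proof -
  \<comment> \<open>\<open>L Q R\<close> is the logarithm of the product with exponents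
    \<open>Q\<close> on \<open>M\<close> and \<open>R\<close> on the counts. The two sides of the
    inequality exchange \<open>P\<close> and \<open>N\<close>.\<close>
  define L where "L Q R = (\<Sum>m\<in>I. \<Sum>j<M. real p * real (Q m) * log 2 (real M)
    + real p * real (R m) * log 2 (real (c m j)))" for Q R :: "'m \<Rightarrow> nat"
  have log: "log 2 (real (\<Prod>m\<in>I. \<Prod>j<M. M ^ (p * Q m) * c m j ^ (p * R m))) = L Q R" for Q R
  proof -
    have "log 2 (real (\<Prod>m\<in>I. \<Prod>j<M. M ^ (p * Q m) * c m j ^ (p * R m)))
      = (\<Sum>m\<in>I. log 2 (\<Prod>j<M. real M ^ (p * Q m) * real (c m j) ^ (p * R m)))"
      unfolding of_nat_prod of_nat_mult of_nat_power
      by (intro log_prod) (use M c in \<open>auto intro!: prod_pos\<close>)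
    also have "\<dots> = L Q R"
      unfolding L_def
    proof (intro sum.cong refl)
      fix m assume m: "m \<in> I"
      have "log 2 (\<Prod>j<M. real M ^ (p * Q m) * real (c m j) ^ (p * R m))
        = (\<Sum>j<M. log 2 (real M ^ (p * Q m) * real (c m j) ^ (p * R m)))"
        by (intro log_prod) (use M c[OF m] in auto)
      also have "\<dots> = (\<Sum>j<M. real p * real (Q m) * log 2 (real M)
          + real p * real (R m) * log 2 (real (c m j)))"
        by (intro sum.cong refl) (use M c[OF m] in \<open>auto simp: log_mult log_nat_power\<close>)
      finally show "log 2 (\<Prod>j<M. real M ^ (p * Q m) * real (c m j) ^ (p * R m)) = \<dots>" .
    qed
    finally show ?thesis .
  qed
  have pos: "0 < (\<Prod>m\<in>I. \<Prod>j<M. M ^ (p * Q m) * c m j ^ (p * R m))" for Q R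
    using M c by (intro prod_pos) auto
  have "?A \<le> ?B \<longleftrightarrow> log 2 (real ?A) \<le> log 2 (real ?B)"
    using pos by (intro nat_le_iff_log_le) auto
  also have "log 2 (real ?B) = M + L P N"
    using pos[of P N] unfolding of_nat_mult[of "2 ^ M"]
    by (subst log_mult) (auto simp: log log_nat_power simp del: of_nat_prod)
  also have "log 2 (real ?A) = L N P" by (rule log)
  also have "L N P \<le> M + L P N \<longleftrightarrow> 0 \<le> L P N - L N P + M" by auto
  \<comment> \<open>The summand \<open>M\<close>, coming from \<open>2 ^ M\<close>, equals
    \<open>p * M\<close> times 1 / p, so the positive factor \<open>p * M\<close> comes out of
    everything.\<close>
  also have "L P N - L N P + M = real p * real M * (?S + 1 / real p)"
  proof -
    have "L P N - L N P = (\<Sum>m\<in>I. \<Sum>j<M. real p * ((real (P m) - real (N m)) *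
        log 2 (real M / real (c m j))))"
      unfolding L_def sum_subtractf[symmetric]
      by (intro sum.cong refl) (use M c in \<open>auto simp: log_divide algebra_simps\<close>)
    also have "\<dots> = real p * real M * ?S"
      using M by (simp add: sum_distrib_left sum_divide_distrib mult.assoc)
    finally show ?thesis using p by (simp add: algebra_simps)
  qed
  also have "0 \<le> real p * real M * (?S + 1 / real p) \<longleftrightarrow> 0 \<le> ?S + 1 / real p"
  proof -
    have "0 < real p * real M" using p M by simp
    then show ?thesis by (subst zero_le_mult_iff) linarith
  qed
  finally show ?thesis .
qed

lemma mean_log_le_iff:
  fixes c :: "nat \<Rightarrow> nat"
  assumes M: "M > 0" and c: "\<And>j. j < M \<Longrightarrow> c j > 0"
  shows "(\<Sum>j<M. log 2 (real M / real (c j))) / real M \<le> real N \<longleftrightarrow>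
    M ^ M \<le> 2 ^ (N * M) * (\<Prod>j<M. c j)"
proof -
  have pos: "0 < (\<Prod>j<M. c j)" using c by (intro prod_pos) auto
  have "M ^ M \<le> 2 ^ (N * M) * (\<Prod>j<M. c j) \<longleftrightarrow>
      log 2 (real (M ^ M)) \<le> log 2 (real (2 ^ (N * M) * (\<Prod>j<M. c j)))"
    using pos M by (intro nat_le_iff_log_le) auto
  also have "log 2 (real (M ^ M)) = M * log 2 M" using M by (simp add: log_nat_power)
  also have "log 2 (real (2 ^ (N * M) * (\<Prod>j<M. c j))) = N * M + log 2 (real (\<Prod>j<M. c j))"
    using pos unfolding of_nat_mult[of "2 ^ (N * M)"]
    by (subst log_mult) (auto simp: log_nat_power simp del: of_nat_prod)
  also have "log 2 (real (\<Prod>j<M. c j)) = (\<Sum>j<M. log 2 (real (c j)))"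
    unfolding of_nat_prod by (intro log_prod) (use c in auto)
  also have "M * log 2 M \<le> N * M + (\<Sum>j<M. log 2 (real (c j))) \<longleftrightarrow>
      (\<Sum>j<M. log 2 (real M / real (c j))) \<le> N * M"
  proof -
    have "(\<Sum>j<M. log 2 (real M / real (c j))) = (\<Sum>j<M. log 2 M - log 2 (c j))"
      by (intro sum.cong refl) (use M c in \<open>auto simp: log_divide\<close>)
    then show ?thesis by (auto simp: sum_subtractf)
  qed
  finally show ?thesis using M by (simp add: field_simps)
qed

section \<open>Correctness of the arithmetical formula\<close>

lemma bij_betw_set_decode: "bij_betw set_decode {..<2 ^ n} (Pow {..<n})"
proof (rule bij_betw_byWitness[where f' = set_encode])
  have less: "set_encode A < 2 ^ n" if "A \<subseteq> {..<n}" for A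
  proof -
    have "set_encode A \<le> set_encode {..<n}"
      unfolding set_encode_def using that by (intro sum_mono2) auto
    also have "set_encode {..<n} < 2 ^ n"
      by (induction n) (auto simp: set_encode_def lessThan_Suc)
    finally show ?thesis .
  qed
  then show "set_encode ` Pow {..<n} \<subseteq> {..<2 ^ n}" by auto
  show "\<forall>m\<in>{..<2 ^ n}. set_encode (set_decode m) = m" by simp
  show "\<forall>A\<in>Pow {..<n}. set_decode (set_encode A) = A"
    using finite_subset by (auto intro!: set_encode_inverse)
  show "set_decode ` {..<2 ^ n} \<subseteq> Pow {..<n}"
  proof clarify
    fix m v assume m: "m < (2::nat) ^ n" "v \<in> set_decode m"
    show "v < n"
    proof (rule ccontr)
      assume "\<not> v < n"
      then have "m < 2 ^ v"
        using m(1) by (meson less_le_trans linorder_not_less one_le_numeral power_increasing)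
      then show False using m(2) by (simp add: set_decode_def)
    qed
  qed
qed

lemma set_decode_full: "set_decode (2 ^ n - 1) = {..<n}"
proof -
  have "set_encode {..<n} = 2 ^ n - 1"
    by (induction n) (auto simp: set_encode_def lessThan_Suc)
  then show ?thesis by (metis finite_lessThan set_encode_inverse)
qed

section \<open>Tables coded as natural numbers\<close>

definition rows_code :: "nat \<Rightarrow> nat \<Rightarrow> nat \<Rightarrow> nat" where
  "rows_code y i v = lnth (lnth y i) v"

lemma agree_code_eq:
  assumes "m < 2 ^ n"
  shows "agree_code n M y m j = agree_count M (rows_code y) (set_decode m) j"
proof -
  have sub: "set_decode m \<subseteq> {..<n}" using bij_betw_set_decode[of n] assms by (auto dest: bij_betwE)
  have "(\<forall>v<n. \<not> even (m div 2 ^ v) \<longrightarrow> lnth (lnth y i) v = lnth (lnth y j) v) \<longleftrightarrow>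
      (\<forall>v\<in>set_decode m. rows_code y i v = rows_code y j v)" for i
    using sub by (auto simp: set_decode_def rows_code_def)
  then show ?thesis
    by (simp add: agree_code_def agree_count_def of_bool_def sum.If_cases Int_def)
qed

lemma rows_code_surj:
  "\<exists>y. \<forall>i<M. \<forall>v<n. rows_code y i v = e i v"
  by (intro exI[of _ "list_encode (map (\<lambda>i. list_encode (map (e i) [0..<n])) [0..<M])"])
    (simp add: rows_code_def lnth_list_encode)

lemma empirical_cong:
  assumes "M > 0" "\<And>i v. i < M \<Longrightarrow> v < n \<Longrightarrow> e i v = e' i v"
  shows "empirical n M e = empirical n M e'"
  unfolding empirical_def using assms
  by (intro map_pmf_cong) (auto simp: lessThan_empty_iff fun_eq_iff)

text \<open>An empirical distribution depends only on the first \<open>M\<close> rows and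
  \<open>n\<close> columns of its table, and some code reproduces any such finite block. Hence a
  quantifier over distributions becomes one over numbers.\<close>

lemma ball_empirical_vectors_iff:
  "(\<forall>h\<in>empirical_vectors n. Q h) \<longleftrightarrow>
    (\<forall>z. Q (entropic_vector n (empirical n (Suc (pfst z)) (rows_code (psnd z)))))"
proof (intro iffI allI ballI)
  fix h assume all: "\<forall>z. Q (entropic_vector n (empirical n (Suc (pfst z)) (rows_code (psnd z))))"
    and "h \<in> empirical_vectors n"
  then obtain M e where M: "M > 0" and h: "h = entropic_vector n (empirical n M e)"
    by (auto simp: empirical_vectors_def)
  obtain y where "\<forall>i<M. \<forall>v<n. rows_code y i v = e i v" using rows_code_surj by blast
  then have "empirical n M (rows_code y) = empirical n M e"
    using M by (intro empirical_cong) auto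
  then show "Q h" using all[rule_format, of "prod_encode (M - 1, y)"] M by (simp add: h)
qed (auto simp: empirical_vectors_def)

lemma entropy_bounded_iff:
  assumes "M > 0"
  shows "entropy_bounded n N M y \<longleftrightarrow> entropic_vector n (empirical n M (rows_code y)) {..<n} \<le> real N"
  using assms agree_count_bounds(1)
  by (simp add: entropy_bounded_def agree_code_eq set_decode_full entropic_vector_empirical mean_log_le_iff
      del: One_nat_def)

lemma length_le_list_encode: "length xs \<le> list_encode xs"
proof (induction xs)
  case (Cons x xs)
  then show ?case using le_prod_encode_2[of "list_encode xs" x] by (auto intro: order_trans)
qed simp

lemma coeff_diff:
  assumes m: "m < 2 ^ n"
  shows "real (coeff_pos (vec_encode n c) (list_encode (map (vec_encode n) cs)) q m)
    - real (coeff_neg (vec_encode n c) (list_encode (map (vec_encode n) cs)) q m)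
    = of_int (c (set_decode m)) - real q * (\<Sum>l<length cs. of_int ((cs ! l) (set_decode m)))"
proof -
  have nth: "lnth (vec_encode n d) m = int_encode (d (set_decode m))" for d
    using m by (simp add: vec_encode_def lnth_list_encode)
  let ?z = "list_encode (map (vec_encode n) cs)"
  \<comment> \<open>Positions past the end of the list contribute \<open>F 0 = 0\<close>, so summing
    up to the code of the list changes nothing.\<close>
  have sum: "(\<Sum>l<?z. F (lnth (lnth ?z l) m)) = (\<Sum>l<length cs. F (int_encode ((cs ! l) (set_decode m))))"
    if "F 0 = 0" for F :: "nat \<Rightarrow> nat"
  proof -
    have "length cs \<le> ?z" using length_le_list_encode[of "map (vec_encode n) cs"] by simp
    then have "(\<Sum>l<?z. F (lnth (lnth ?z l) m)) = (\<Sum>l<length cs. F (lnth (lnth ?z l) m))"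
      using that by (intro sum.mono_neutral_right) (auto simp: lnth_list_encode lnth_0)
    also have "\<dots> = (\<Sum>l<length cs. F (int_encode ((cs ! l) (set_decode m))))"
      by (intro sum.cong) (auto simp: lnth_list_encode nth)
    finally show ?thesis .
  qed
  show ?thesis
    unfolding coeff_pos_def coeff_neg_def
    by (simp add: sum[of pos_part, OF pos_part_0] sum[of neg_part, OF neg_part_0] nth
        pos_part_neg_part_int_encode[symmetric] sum_subtractf algebra_simps)
qed

lemma inequality_holds_iff:
  assumes M: "M > 0" and p: "p > 0"
  shows "inequality_holds n (vec_encode n c) (list_encode (map (vec_encode n) cs)) p q M y \<longleftrightarrow>
    0 \<le> vec_dot n (\<lambda>\<alpha>. of_int (c \<alpha>)) (entropic_vector n (empirical n M (rows_code y)))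
      - real q * (\<Sum>l<length cs. vec_dot n (\<lambda>\<alpha>. of_int ((cs ! l) \<alpha>))
          (entropic_vector n (empirical n M (rows_code y))))
      + 1 / real p"
proof -
  define h where "h = entropic_vector n (empirical n M (rows_code y))"
  let ?c = "vec_encode n c" and ?cs = "list_encode (map (vec_encode n) cs)"
  have h: "(\<Sum>j<M. log 2 (real M / real (agree_code n M y m j))) / real M = h (set_decode m)"
    if "m < 2 ^ n" for m
    using that M bij_betw_set_decode[of n]
    by (auto simp: h_def agree_code_eq entropic_vector_empirical dest!: bij_betwE)
  have "inequality_holds n ?c ?cs p q M y \<longleftrightarrow>
    0 \<le> (\<Sum>m<2 ^ n. (real (coeff_pos ?c ?cs q m) - real (coeff_neg ?c ?cs q m)) *
        ((\<Sum>j<M. log 2 (real M / real (agree_code n M y m j))) / real M)) + 1 / real p"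
    unfolding inequality_holds_def
    by (rule prod_power_le_iff_log[OF M p]) (simp add: agree_code_eq agree_count_bounds)
  also have "(\<Sum>m<2 ^ n. (real (coeff_pos ?c ?cs q m) - real (coeff_neg ?c ?cs q m)) *
        ((\<Sum>j<M. log 2 (real M / real (agree_code n M y m j))) / real M))
      = (\<Sum>m<2 ^ n. (of_int (c (set_decode m))
          - real q * (\<Sum>l<length cs. of_int ((cs ! l) (set_decode m)))) * h (set_decode m))"
    by (intro sum.cong refl) (simp add: h coeff_diff)
  \<comment> \<open>Bit masks below \<open>2 ^ n\<close> correspond bijectively to subsets of the
    variables; linearity then separates the consequent from the antecedents.\<close>
  also have "\<dots> = (\<Sum>\<alpha>\<in>Pow {..<n}. (of_int (c \<alpha>) - real q * (\<Sum>l<length cs. of_int ((cs ! l) \<alpha>))) * h \<alpha>)"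
    by (rule sum.reindex_bij_betw[OF bij_betw_set_decode])
  also have "\<dots> = vec_dot n (\<lambda>\<alpha>. of_int (c \<alpha>)) h
      - real q * (\<Sum>l<length cs. vec_dot n (\<lambda>\<alpha>. of_int ((cs ! l) \<alpha>)) h)"
    unfolding vec_dot_def
    by (subst sum.swap) (simp add: algebra_simps sum_subtractf sum_distrib_left sum_distrib_right)
  finally show ?thesis by (simp add: h_def)
qed

section \<open>Equivalence of the conditional inequality with the arithmetical formula\<close>

theorem corollary11:
  shows "\<exists>A\<in>Pi_0_3. \<forall>(n::nat) (c0::nat set \<Rightarrow> int) (cs::(nat set \<Rightarrow> int) list).
    (\<forall>c\<in>set cs. tight_vec n (\<lambda>\<alpha>. real_of_int (c \<alpha>))) \<longrightarrow>
    (input_encode n c0 cs \<in> A \<longleftrightarrow> AECIIP n c0 cs)"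
proof (intro bexI allI impI)
  show "{x. \<forall>N. \<exists>q. \<forall>z. pi3_matrix x N q z} \<in> Pi_0_3"
    unfolding Pi_0_3_def using decidable4_pi3_matrix by blast
next
  fix n c0 and cs :: "(nat set \<Rightarrow> int) list"
  assume tight: "\<forall>c\<in>set cs. tight_vec n (\<lambda>\<alpha>. real_of_int (c \<alpha>))"
  define f where "f = vec_dot n (\<lambda>\<alpha>. of_int (c0 \<alpha>))"
  define g where "g h = (\<Sum>l<length cs. vec_dot n (\<lambda>\<alpha>. of_int ((cs ! l) \<alpha>)) h)" for h
  have nonpos: "vec_dot n (\<lambda>\<alpha>. of_int ((cs ! l) \<alpha>)) h \<le> 0"
    if "h \<in> almost_entropic n" "l < length cs" for h l
    using tight that by (auto simp: tight_vec_def)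
  \<comment> \<open>Nonpositive summands with a nonnegative sum must all vanish, so one inequality
    on the sum captures all the antecedents.\<close>
  have g_iff: "0 \<le> g h \<longleftrightarrow> (\<forall>c\<in>set cs. 0 \<le> vec_dot n (\<lambda>\<alpha>. of_int (c \<alpha>)) h)"
    if h: "h \<in> almost_entropic n" for h
  proof
    assume "0 \<le> g h"
    moreover have "g h \<le> 0" using nonpos[OF h] by (auto simp: g_def intro!: sum_nonpos)
    ultimately have "g h = 0" by simp
    then have "(\<Sum>l<length cs. - vec_dot n (\<lambda>\<alpha>. of_int ((cs ! l) \<alpha>)) h) = 0"
      by (simp add: g_def sum_negf)
    then have "\<forall>l\<in>{..<length cs}. - vec_dot n (\<lambda>\<alpha>. of_int ((cs ! l) \<alpha>)) h = 0"
      using nonpos[OF h] by (subst (asm) sum_nonneg_eq_0_iff) auto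
    then show "\<forall>c\<in>set cs. 0 \<le> vec_dot n (\<lambda>\<alpha>. of_int (c \<alpha>)) h"
      by (auto simp: in_set_conv_nth)
  qed (auto simp: g_def intro!: sum_nonneg)
  have "AECIIP n c0 cs \<longleftrightarrow> (\<forall>h\<in>almost_entropic n. 0 \<le> g h \<longrightarrow> 0 \<le> f h)"
    by (simp add: AECIIP_def g_iff f_def)
  also have "\<dots> \<longleftrightarrow> (\<forall>N. \<exists>q. \<forall>h\<in>empirical_vectors n. h {..<n} \<le> real N \<longrightarrow>
      0 \<le> f h - real q * g h + 1 / real (Suc N))"
    \<comment> \<open>The dominating coordinate is the joint entropy, at the index
      \<open>{..<n}\<close>; the bounds are required only on the dense set.\<close>
    unfolding almost_entropic_eq_closure_empirical
  proof (rule closure_implication_iff)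
    show "empirical_vectors n \<subseteq> extensional (Pow {..<n})"
      by (auto simp: empirical_vectors_def entropic_vector_def)
    show "continuous_map (powertop_real (Pow {..<n})) euclideanreal f"
      unfolding f_def by (rule continuous_map_vec_dot)
    show "continuous_map (powertop_real (Pow {..<n})) euclideanreal g"
      unfolding g_def by (intro continuous_map_sum continuous_map_vec_dot) auto
    show "g h \<le> 0" if "h \<in> powertop_real (Pow {..<n}) closure_of empirical_vectors n" for h
      using that nonpos unfolding almost_entropic_eq_closure_empirical[symmetric]
      by (auto simp: g_def intro!: sum_nonpos)
  qed (use empirical_vectors_bounds in auto)
  also have "\<dots> \<longleftrightarrow> (\<forall>N. \<exists>q. \<forall>z. pi3_matrix (input_encode n c0 cs) N q z)"
    unfolding ball_empirical_vectors_iff pi3_matrix_def input_encode_def pfst_prod_encode psnd_prod_encode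
    by (simp only: entropy_bounded_iff inequality_holds_iff zero_less_Suc f_def g_def)
  finally show "input_encode n c0 cs \<in> {x. \<forall>N. \<exists>q. \<forall>z. pi3_matrix x N q z} \<longleftrightarrow> AECIIP n c0 cs"
    by simp
qed

end
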